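(* Let $f:\mathbb{GA}_N\to\mathbb{G\overline A}_N$ be a mapping of affine connection spaces whose symmetrized deformation tensor satisfies $$P^i_{\underline{jk}}=\overline\omega{}^i_{(1).jk}-\omega^i_{(1).jk}=\overline\omega{}^i_{(2).jk}-\omega^i_{(2).jk}=\overline\omega{}^i_{(3).jk}-\omega^i_{(3).jk},$$ where $$\omega^i_{(1).jk}=L^i_{\underline{jk}},\qquad \omega^i_{(2).jk}=\omega^i_{jk},\qquad \omega^i_{(3).jk}=-\tfrac12P^i_{\underline{jk}},$$ and $\overline\omega{}^i_{(1).jk}=\overline L{}^i_{\underline{jk}}$, $\overline\omega{}^i_{(2).jk}=\overline\omega{}^i_{jk}$, $\overline\omega{}^i_{(3).jk}=-\tfrac12\overline P{}^i_{\underline{jk}}$. Then: (a) the geometrical objects $$\widetilde{\mathcal T}{}^i_{(1).jk}=0,\qquad \widetilde{\mathcal T}{}^i_{(2).jk}=L^i_{\underline{jk}}-\omega^i_{jk},\qquad \widetilde{\mathcal T}{}^i_{(3).jk}=\tfrac12\big(\overline L{}^i_{\underline{jk}}+L^i_{\underline{jk}}\big)$$ are invariants of the mapping $f$; (b) for each $p=1,2,3$, the geometrical object $$\widetilde{\mathcal W}{}^i_{(p).jmn}=R^i_{jmn}-\omega^i_{(p).jm|n}+\omega^i_{(p).jn|m}+\omega^\alpha_{(p).jm}\omega^i_{(p).\alpha n}-\omega^\alpha_{(p).jn}\omega^i_{(p).\alpha m}$$ (no summation over $p$) is an invariant of the mapping $f$.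
   Context: $\mathbb{GA}_N$ and $\mathbb{G\overline A}_N$ denote the same $N$-dimensional manifold $\mathcal M_N$ equipped with affine connections $\nabla$ and $\overline\nabla=f(\nabla)$ (possibly with torsion), with coefficients $L^i_{jk}$ and $\overline L{}^i_{jk}$ in common local coordinates $x^1,\dots,x^N$. Passing from $\nabla$ to $\overline\nabla$ is called the mapping $f$. The summation convention is used for repeated Greek indices. A comma denotes a partial derivative. A geometrical object is a family of smooth functions indexed by its indices in coordinates; it need not be a tensor. For any object $A^i_{jk}$, $A^i_{\underline{jk}}=\frac12(A^i_{jk}+A^i_{kj})$ is its symmetric part in $j,k$. The associated space $\mathbb A_N$ is $\mathcal M_N$ with the torsion-free connection with coefficients $L^i_{\underline{jk}}$. The covariant derivative with respect to this connection is denoted by $|$ and is applied formally to any indexed object by the tensor formula; e.g. for $a^i_{jm}$, $$a^i_{jm|n}=a^i_{jm,n}+L^i_{\underline{\alpha n}}a^\alpha_{jm}-L^\alpha_{\underline{jn}}a^i_{\alpha m}-L^\alpha_{\underline{mn}}a^i_{j\alpha}.$$ The corresponding derivative for $\overline L{}^i_{\underline{jk}}$ is denoted by $\|$. The curvature tensor of $\mathbb A_N$ is $$R^i_{jmn}=L^i_{\underline{jm},n}-L^i_{\underline{jn},m}+L^\alpha_{\underline{jm}}L^i_{\underline{\alpha n}}-L^\alpha_{\underline{jn}}L^i_{\underline{\alpha m}},$$ and $\overline R{}^i_{jmn}$ is defined likewise from $\overline L$. The deformation tensor of $f$ is $P^i_{jk}=\overline L{}^i_{jk}-L^i_{jk}$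 and that of the inverse map is $\overline P{}^i_{jk}=L^i_{jk}-\overline L{}^i_{jk}=-P^i_{jk}$. One assumes that $$P^i_{jk}=\overline\omega{}^i_{jk}-\omega^i_{jk}+\overline\tau{}^i_{jk}-\tau^i_{jk},$$ where $\omega^i_{jk},\overline\omega{}^i_{jk}$ are geometrical objects symmetric in $j,k$ and $\tau^i_{jk},\overline\tau{}^i_{jk}$ are geometrical objects antisymmetric in $j,k$. Given an object built from the data of $\mathbb{GA}_N$ (i.e. $L,\omega,\tau,P,\overline L$, partial derivatives and $|$), the corresponding overlined object is obtained by interchanging the roles of the two spaces ($L\leftrightarrow\overline L$, $\omega\leftrightarrow\overline\omega$, $\tau\leftrightarrow\overline\tau$, $P\leftrightarrow\overline P$, $|\leftrightarrow\|$). An object is an invariant of $f$ if it equals its corresponding overlined object. *)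

theory Defs
  imports "HOL-Analysis.Analysis"
begin

section \<open>Smooth manifolds\<close>

definition partial :: "'n::finite \<Rightarrow> (real^'n \<Rightarrow> real) \<Rightarrow> real^'n \<Rightarrow> real" where
  "partial k f x = frechet_derivative f (at x) (axis k 1)"

fun Ck_on :: "nat \<Rightarrow> (real^'n::finite) set \<Rightarrow> (real^'n \<Rightarrow> real) \<Rightarrow> bool" where
  "Ck_on 0 U f \<longleftrightarrow> continuous_on U f"
| "Ck_on (Suc r) U f \<longleftrightarrow>
     (\<forall>x\<in>U. f differentiable (at x)) \<and> (\<forall>k. Ck_on r U (partial k f))"

text \<open>Only used for open \<open>U\<close>.\<close>

definition smooth_on :: "(real^'n::finite) set \<Rightarrow> (real^'n \<Rightarrow> real) \<Rightarrow> bool" where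
  "smooth_on U f \<longleftrightarrow> (\<forall>r. Ck_on r U f)"

text \<open>A chart is a pair of an open set of the manifold and a coordinate map on it;
  the map is irrelevant outside this set.\<close>

type_synonym ('m, 'n) chart = "'m set \<times> ('m \<Rightarrow> real^'n)"

definition chart_image :: "('m, 'n::finite) chart \<Rightarrow> (real^'n) set" where
  "chart_image c = snd c ` fst c"

definition is_chart :: "'m topology \<Rightarrow> ('m, 'n::finite) chart \<Rightarrow> bool" where
  "is_chart X c \<longleftrightarrow>
     openin X (fst c) \<and> open (chart_image c) \<and>
     homeomorphic_map (subtopology X (fst c)) (top_of_set (chart_image c)) (snd c)"

text \<open>The change of coordinates from \<open>c\<close> to \<open>c'\<close>, meaningful on the \<open>c\<close>-image of the
  common domain.\<close>

definition transition :: "('m, 'n::finite) chart \<Rightarrow> ('m, 'n) chart \<Rightarrow> real^'n \<Rightarrow> real^'n" where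
  "transition c c' x = snd c' (inv_into (fst c) (snd c) x)"

definition smooth_manifold :: "'m topology \<Rightarrow> ('m, 'n::finite) chart set \<Rightarrow> bool" where
  "smooth_manifold X \<A> \<longleftrightarrow>
     Hausdorff_space X \<and> second_countable X \<and>
     (\<forall>c\<in>\<A>. is_chart X c) \<and> (\<Union>c\<in>\<A>. fst c) = topspace X \<and>
     (\<forall>c\<in>\<A>. \<forall>c'\<in>\<A>. \<forall>i.
        smooth_on (snd c ` (fst c \<inter> fst c')) (\<lambda>x. transition c c' x $ i))"


section \<open>Geometrical objects and affine connections\<close>

text \<open>An indexed object assigns to every chart and every tuple of indices a function of the
  coordinates: \<open>A c (i, j, k) x\<close> is $A^i_{jk}$ at the point with coordinates \<open>x\<close> in the chart
  \<open>c\<close>. No transformation law is imposed. Only the values on the images of the charts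
  matter, so objects are compared there.\<close>

type_synonym ('m, 'n, 'i) object = "('m, 'n) chart \<Rightarrow> 'i \<Rightarrow> real^'n \<Rightarrow> real"
type_synonym ('m, 'n) object3 = "('m, 'n, 'n \<times> 'n \<times> 'n) object"
type_synonym ('m, 'n) object4 = "('m, 'n, 'n \<times> 'n \<times> 'n \<times> 'n) object"

definition geometrical_object ::
    "('m, 'n::finite) chart set \<Rightarrow> ('m, 'n, 'i) object \<Rightarrow> bool" where
  "geometrical_object \<A> A \<longleftrightarrow> (\<forall>c\<in>\<A>. \<forall>I. smooth_on (chart_image c) (A c I))"

definition object_eq ::
    "('m, 'n::finite) chart set \<Rightarrow> ('m, 'n, 'i) object \<Rightarrow> ('m, 'n, 'i) object \<Rightarrow> bool" where
  "object_eq \<A> A B \<longleftrightarrow> (\<forall>c\<in>\<A>. \<forall>I. \<forall>x\<in>chart_image c. A c I x = B c I x)"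

definition sympart :: "('m, 'n::finite) object3 \<Rightarrow> ('m, 'n) object3" where
  "sympart A = (\<lambda>c (i, j, k) x. (A c (i, j, k) x + A c (i, k, j) x) / 2)"

definition symmetric_object :: "('m, 'n::finite) chart set \<Rightarrow> ('m, 'n) object3 \<Rightarrow> bool" where
  "symmetric_object \<A> A \<longleftrightarrow> object_eq \<A> A (\<lambda>c (i, j, k) x. A c (i, k, j) x)"

definition antisymmetric_object :: "('m, 'n::finite) chart set \<Rightarrow> ('m, 'n) object3 \<Rightarrow> bool" where
  "antisymmetric_object \<A> A \<longleftrightarrow> object_eq \<A> A (\<lambda>c (i, j, k) x. - A c (i, k, j) x)"

text \<open>Coefficients of an affine connection, possibly with torsion, with the transformation law
  $L'^i_{jk} = \frac{\partial x'^i}{\partial x^\alpha}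
    \bigl(\frac{\partial^2 x^\alpha}{\partial x'^j\,\partial x'^k}
    + L^\alpha_{\beta\gamma}\frac{\partial x^\beta}{\partial x'^j}
      \frac{\partial x^\gamma}{\partial x'^k}\bigr)$,
  where \<open>x\<close> and \<open>x'\<close> are the coordinates of the point \<open>p\<close> in \<open>c\<close> and \<open>c'\<close>.\<close>

definition affine_connection :: "('m, 'n::finite) chart set \<Rightarrow> ('m, 'n) object3 \<Rightarrow> bool" where
  "affine_connection \<A> L \<longleftrightarrow>
     geometrical_object \<A> L \<and>
     (\<forall>c\<in>\<A>. \<forall>c'\<in>\<A>. \<forall>p\<in>fst c \<inter> fst c'. \<forall>i j k.
        let x = snd c p; x' = snd c' p in
        L c' (i, j, k) x' =
          (\<Sum>\<alpha>\<in>UNIV. partial \<alpha> (\<lambda>y. transition c c' y $ i) x *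
             (partial k (partial j (\<lambda>y. transition c' c y $ \<alpha>)) x' +
              (\<Sum>\<beta>\<in>UNIV. \<Sum>\<gamma>\<in>UNIV. L c (\<alpha>, \<beta>, \<gamma>) x *
                 partial j (\<lambda>y. transition c' c y $ \<beta>) x' *
                 partial k (\<lambda>y. transition c' c y $ \<gamma>) x'))))"

text \<open>Covariant derivative with respect to the symmetrization of \<open>L\<close>, applied formally:
  \<open>cov L a c (i, j, m, n)\<close> is $a^i_{jm|n}$.\<close>

definition cov :: "('m, 'n::finite) object3 \<Rightarrow> ('m, 'n) object3 \<Rightarrow> ('m, 'n) object4" where
  "cov L a = (\<lambda>c (i, j, m, n) x.
     partial n (a c (i, j, m)) x
     + (\<Sum>\<alpha>\<in>UNIV. sympart L c (i, \<alpha>, n) x * a c (\<alpha>, j, m) x)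
     - (\<Sum>\<alpha>\<in>UNIV. sympart L c (\<alpha>, j, n) x * a c (i, \<alpha>, m) x)
     - (\<Sum>\<alpha>\<in>UNIV. sympart L c (\<alpha>, m, n) x * a c (i, j, \<alpha>) x))"

text \<open>Curvature of the associated space, with the torsion-free coefficients \<open>sympart L\<close>.\<close>

definition curvature :: "('m, 'n::finite) object3 \<Rightarrow> ('m, 'n) object4" where
  "curvature L = (\<lambda>c (i, j, m, n) x.
     partial n (sympart L c (i, j, m)) x
     - partial m (sympart L c (i, j, n)) x
     + (\<Sum>\<alpha>\<in>UNIV. sympart L c (\<alpha>, j, m) x * sympart L c (i, \<alpha>, n) x)
     - (\<Sum>\<alpha>\<in>UNIV. sympart L c (\<alpha>, j, n) x * sympart L c (i, \<alpha>, m) x))"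


section \<open>Mappings and their invariants\<close>

text \<open>An affine connection space over a fixed manifold, together with the objects that
  this space contributes to the deformation tensor of a mapping. A mapping is a pair \<open>G\<close>,
  \<open>G'\<close> of such spaces, \<open>G'\<close> being the overlined one. An object built from
  the data of the mapping is a function \<open>\<Phi>\<close> of both spaces, and the corresponding overlined object
  is obtained by interchanging the arguments.\<close>

record ('m, 'n::finite) ga_space =
  coeff :: "('m, 'n) object3"
  omega :: "('m, 'n) object3"
  tau   :: "('m, 'n) object3"

definition is_ga_space :: "('m, 'n::finite) chart set \<Rightarrow> ('m, 'n) ga_space \<Rightarrow> bool" where
  "is_ga_space \<A> G \<longleftrightarrow>
     affine_connection \<A> (coeff G) \<and>
     geometrical_object \<A> (omega G) \<and> symmetric_object \<A> (omega G) \<and>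
     geometrical_object \<A> (tau G) \<and> antisymmetric_object \<A> (tau G)"

type_synonym ('m, 'n, 'i) built_object =
  "('m, 'n) ga_space \<Rightarrow> ('m, 'n) ga_space \<Rightarrow> ('m, 'n, 'i) object"

definition deformation :: "('m, 'n::finite, 'n \<times> 'n \<times> 'n) built_object" where
  "deformation G G' = (\<lambda>c I x. coeff G' c I x - coeff G c I x)"

definition is_mapping ::
    "('m, 'n::finite) chart set \<Rightarrow> ('m, 'n) ga_space \<Rightarrow> ('m, 'n) ga_space \<Rightarrow> bool" where
  "is_mapping \<A> G G' \<longleftrightarrow>
     is_ga_space \<A> G \<and> is_ga_space \<A> G' \<and>
     object_eq \<A> (deformation G G')
       (\<lambda>c I x. omega G' c I x - omega G c I x + tau G' c I x - tau G c I x)"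

definition invariant ::
    "('m, 'n::finite) chart set \<Rightarrow> ('m, 'n) ga_space \<Rightarrow> ('m, 'n) ga_space \<Rightarrow>
     ('m, 'n, 'i) built_object \<Rightarrow> bool" where
  "invariant \<A> G G' \<Phi> \<longleftrightarrow>
     geometrical_object \<A> (\<Phi> G G') \<and> object_eq \<A> (\<Phi> G G') (\<Phi> G' G)"

definition omega1 :: "('m, 'n::finite, 'n \<times> 'n \<times> 'n) built_object" where
  "omega1 G G' = sympart (coeff G)"

definition omega2 :: "('m, 'n::finite, 'n \<times> 'n \<times> 'n) built_object" where
  "omega2 G G' = omega G"

definition omega3 :: "('m, 'n::finite, 'n \<times> 'n \<times> 'n) built_object" where
  "omega3 G G' = (\<lambda>c I x. - (1/2) * sympart (deformation G G') c I x)"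

definition T1 :: "('m, 'n::finite, 'n \<times> 'n \<times> 'n) built_object" where
  "T1 G G' = (\<lambda>c I x. 0)"

definition T2 :: "('m, 'n::finite, 'n \<times> 'n \<times> 'n) built_object" where
  "T2 G G' = (\<lambda>c I x. sympart (coeff G) c I x - omega G c I x)"

definition T3 :: "('m, 'n::finite, 'n \<times> 'n \<times> 'n) built_object" where
  "T3 G G' = (\<lambda>c I x. (1/2) * (sympart (coeff G') c I x + sympart (coeff G) c I x))"

definition W :: "('m, 'n::finite, 'n \<times> 'n \<times> 'n) built_object \<Rightarrow>
    ('m, 'n, 'n \<times> 'n \<times> 'n \<times> 'n) built_object" where
  "W om G G' = (\<lambda>c (i, j, m, n) x. let w = om G G' in
     curvature (coeff G) c (i, j, m, n) x
     - cov (coeff G) w c (i, j, m, n) x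
     + cov (coeff G) w c (i, j, n, m) x
     + (\<Sum>\<alpha>\<in>UNIV. w c (\<alpha>, j, m) x * w c (i, \<alpha>, n) x)
     - (\<Sum>\<alpha>\<in>UNIV. w c (\<alpha>, j, n) x * w c (i, \<alpha>, m) x))"

end

theory Submission
  imports Defs
begin

text \<open>Write \<open>S\<close> for the symmetrized coefficients. The hypothesis on the deformation tensor
  says that \<open>T = S - w\<close> agrees with its overlined counterpart, where \<open>w\<close> is any of the
  three $\omega_{(p)}$, and these differences are the objects of part (a). Since \<open>S\<close> is
  symmetric, the terms $S^\alpha_{mn} w^i_{j\alpha}$ of the two covariant derivatives cancel,
  and completing the products shows that the object of part (b) is the curvature expression
  formed with \<open>T\<close> in place of the connection coefficients.\<close>

section \<open>Calculus of smooth functions\<close>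

text \<open>\<open>frechet_derivative\<close> chooses among all derivatives at the point, and
  functions agreeing on an open set have the same ones there. The equality therefore also covers
  points without differentiability.\<close>

lemma partial_cong:
  assumes "open U" "x \<in> U" "\<And>y. y \<in> U \<Longrightarrow> f y = g y"
  shows "partial k f x = partial k g x"
proof -
  have "(f has_derivative D) (at x) \<longleftrightarrow> (g has_derivative D) (at x)" for D
    using assms has_derivative_transform_within_open[of f D x UNIV U g]
      has_derivative_transform_within_open[of g D x UNIV U f] by auto
  then show ?thesis
    by (simp add: partial_def frechet_derivative_def)
qed

lemma partial_add:
  assumes "f differentiable (at x)" "g differentiable (at x)"
  shows "partial k (\<lambda>x. f x + g x) x = partial k f x + partial k g x"
  unfolding partial_def
  by (simp flip: frechet_derivative_at[OF has_derivative_add[OF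
        assms[unfolded frechet_derivative_works]]])

lemma partial_diff:
  assumes "f differentiable (at x)" "g differentiable (at x)"
  shows "partial k (\<lambda>x. f x - g x) x = partial k f x - partial k g x"
  unfolding partial_def
  by (simp flip: frechet_derivative_at[OF has_derivative_diff[OF
        assms[unfolded frechet_derivative_works]]])

lemma partial_mult:
  assumes "f differentiable (at x)" "g differentiable (at x)"
  shows "partial k (\<lambda>x. f x * g x) x = f x * partial k g x + partial k f x * g x"
  unfolding partial_def
  by (simp flip: frechet_derivative_at[OF has_derivative_mult[OF
        assms[unfolded frechet_derivative_works]]])

lemma partial_const: "partial k (\<lambda>x. c) = (\<lambda>x. 0)"
  by (simp add: partial_def fun_eq_iff)

text \<open>The sum and product rules hold only at points of \<open>U\<close>, so the inductions on
  the order must replace a partial derivative by a function that equals it merely on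
  \<open>U\<close>.\<close>

lemma Ck_on_cong:
  assumes "open U" "\<And>x. x \<in> U \<Longrightarrow> f x = g x" "Ck_on r U f"
  shows "Ck_on r U g"
  using assms(2,3)
proof (induction r arbitrary: f g)
  case 0
  then show ?case by (simp cong: continuous_on_cong)
next
  case (Suc r)
  have "g differentiable (at x)" if "x \<in> U" for x
    using Suc.prems that assms(1) has_derivative_transform_within_open[of f _ x UNIV U g]
    unfolding differentiable_def Ck_on.simps by blast
  moreover have "Ck_on r U (partial k g)" for k
    using Suc.IH[of "partial k f" "partial k g"] Suc.prems partial_cong[OF assms(1), of _ f g]
    by simp
  ultimately show ?case by simp
qed

lemma Ck_on_Suc_imp: "Ck_on (Suc r) U f \<Longrightarrow> Ck_on r U f"
proof (induction r arbitrary: f)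
  case 0
  then show ?case
    by (auto intro!: differentiable_imp_continuous_on differentiable_at_imp_differentiable_on)
next
  case (Suc r)
  then show ?case using Ck_on.simps(2) by blast
qed

lemma Ck_on_const: "Ck_on r U (\<lambda>x. c)"
  by (induction r arbitrary: c) (simp_all add: partial_const)

lemma Ck_on_add:
  assumes "open U" "Ck_on r U f" "Ck_on r U g"
  shows "Ck_on r U (\<lambda>x. f x + g x)"
  using assms(2,3)
proof (induction r arbitrary: f g)
  case 0
  then show ?case by (simp add: continuous_on_add)
next
  case (Suc r)
  have "Ck_on r U (partial k (\<lambda>x. f x + g x))" for k
    by (rule Ck_on_cong[OF assms(1) _ Suc.IH[of "partial k f" "partial k g"]])
      (use Suc.prems in \<open>auto simp: partial_add\<close>)
  then show ?case using Suc.prems by simp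
qed

text \<open>The product rule leaves one factor undifferentiated in each summand, so the induction
  hypothesis also needs \<open>f\<close> and \<open>g\<close> themselves at order \<open>r\<close>;
  \<open>Ck_on_Suc_imp\<close> supplies this.\<close>

lemma Ck_on_mult:
  assumes "open U" "Ck_on r U f" "Ck_on r U g"
  shows "Ck_on r U (\<lambda>x. f x * g x)"
  using assms(2,3)
proof (induction r arbitrary: f g)
  case 0
  then show ?case by (simp add: continuous_on_mult)
next
  case (Suc r)
  have "Ck_on r U (partial k (\<lambda>x. f x * g x))" for k
    by (rule Ck_on_cong[OF assms(1) _ Ck_on_add[OF assms(1)
            Suc.IH[of f "partial k g"] Suc.IH[of "partial k f" g]]])
      (use Suc.prems Ck_on_Suc_imp[of r U] in \<open>auto simp: partial_mult\<close>)
  then show ?case using Suc.prems by simp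
qed

lemma smooth_on_const: "smooth_on U (\<lambda>x. c)"
  by (simp add: smooth_on_def Ck_on_const)

lemma smooth_on_cong:
  assumes "open U" "\<And>x. x \<in> U \<Longrightarrow> f x = g x" "smooth_on U f"
  shows "smooth_on U g"
  using assms Ck_on_cong unfolding smooth_on_def by blast

lemma smooth_on_add:
  "open U \<Longrightarrow> smooth_on U f \<Longrightarrow> smooth_on U g \<Longrightarrow> smooth_on U (\<lambda>x. f x + g x)"
  by (simp add: smooth_on_def Ck_on_add)

lemma smooth_on_mult:
  "open U \<Longrightarrow> smooth_on U f \<Longrightarrow> smooth_on U g \<Longrightarrow> smooth_on U (\<lambda>x. f x * g x)"
  by (simp add: smooth_on_def Ck_on_mult)

lemma smooth_on_cmult: "open U \<Longrightarrow> smooth_on U f \<Longrightarrow> smooth_on U (\<lambda>x. a * f x)"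
  by (simp add: smooth_on_mult smooth_on_const)

lemma smooth_on_diff:
  "open U \<Longrightarrow> smooth_on U f \<Longrightarrow> smooth_on U g \<Longrightarrow> smooth_on U (\<lambda>x. f x - g x)"
  using smooth_on_add[of U f "\<lambda>x. (-1) * g x"] smooth_on_cmult[of U g "-1"] by simp

lemma smooth_on_sum:
  assumes "open U" "\<And>a. a \<in> A \<Longrightarrow> smooth_on U (f a)"
  shows "smooth_on U (\<lambda>x. \<Sum>a\<in>A. f a x)"
  using assms(2)
  by (induction A rule: infinite_finite_induct)
    (simp_all add: smooth_on_const smooth_on_add[OF assms(1)])

lemma smooth_on_partial: "smooth_on U f \<Longrightarrow> smooth_on U (partial k f)"
  unfolding smooth_on_def using Ck_on.simps(2)[of _ U f] by blast

lemma smooth_on_differentiable: "smooth_on U f \<Longrightarrow> x \<in> U \<Longrightarrow> f differentiable (at x)"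
  unfolding smooth_on_def using Ck_on.simps(2)[of 0 U f] by blast


section \<open>Invariants from differences of connection coefficients\<close>

text \<open>The curvature expression without the symmetrization built into \<open>curvature\<close>.\<close>

definition formal_curvature :: "('m, 'n::finite) object3 \<Rightarrow> ('m, 'n) object4" where
  "formal_curvature T = (\<lambda>c (i, j, m, n) x.
     partial n (T c (i, j, m)) x - partial m (T c (i, j, n)) x
     + (\<Sum>\<alpha>\<in>UNIV. T c (\<alpha>, j, m) x * T c (i, \<alpha>, n) x)
     - (\<Sum>\<alpha>\<in>UNIV. T c (\<alpha>, j, n) x * T c (i, \<alpha>, m) x))"

text \<open>With \<open>om\<close> as a parameter, one argument serves all three choices of
  omega.\<close>

definition sym_coeff_minus :: "('m, 'n::finite, 'n \<times> 'n \<times> 'n) built_object \<Rightarrow>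
    ('m, 'n, 'n \<times> 'n \<times> 'n) built_object" where
  "sym_coeff_minus om G G' = (\<lambda>c I x. sympart (coeff G) c I x - om G G' c I x)"

lemma T1_eq: "T1 = sym_coeff_minus omega1"
  by (simp add: fun_eq_iff T1_def sym_coeff_minus_def omega1_def)

lemma T2_eq: "T2 = sym_coeff_minus omega2"
  by (simp add: fun_eq_iff T2_def sym_coeff_minus_def omega2_def)

lemma sympart_deformation:
  "sympart (deformation G G') c I x = sympart (coeff G') c I x - sympart (coeff G) c I x"
  by (cases I) (simp add: sympart_def deformation_def field_simps)

text \<open>Subtracting \<open>omega3\<close> adds half of the symmetrized deformation: S + (S' -
  S)/2 = (S + S')/2.\<close>

lemma T3_eq: "T3 = sym_coeff_minus omega3"
  by (simp add: fun_eq_iff T3_def sym_coeff_minus_def omega3_def sympart_deformation field_simps)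

lemma sympart_swap: "sympart A c (i, j, k) = sympart A c (i, k, j)"
  by (simp add: sympart_def add.commute)

text \<open>Carries smoothness from \<open>formal_curvature\<close> over to \<open>W\<close>, since
  the two are only known to agree on chart images.\<close>

lemma geometrical_object_cong:
  assumes "\<And>c. c \<in> \<A> \<Longrightarrow> open (chart_image c)" "object_eq \<A> A B" "geometrical_object \<A> A"
  shows "geometrical_object \<A> B"
  using assms smooth_on_cong unfolding geometrical_object_def object_eq_def by metis

lemma geometrical_object_sympart:
  assumes "\<And>c. c \<in> \<A> \<Longrightarrow> open (chart_image c)" "geometrical_object \<A> A"
  shows "geometrical_object \<A> (sympart A)"
proof -
  \<comment> \<open>The division becomes a constant factor, the form that
    \<open>smooth_on_cmult\<close> matches.\<close>
  have "sympart A = (\<lambda>c (i, j, k) x. (1/2) * (A c (i, j, k) x + A c (i, k, j) x))"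
    by (simp add: sympart_def fun_eq_iff)
  then show ?thesis
    using assms
    by (auto simp: geometrical_object_def simp del: times_divide_eq_left mult_1
        intro!: smooth_on_cmult smooth_on_add)
qed

lemma geometrical_object_formal_curvature:
  assumes "\<And>c. c \<in> \<A> \<Longrightarrow> open (chart_image c)" "geometrical_object \<A> T"
  shows "geometrical_object \<A> (formal_curvature T)"
  using assms unfolding geometrical_object_def formal_curvature_def
  by (auto intro!: smooth_on_diff smooth_on_add smooth_on_sum smooth_on_mult smooth_on_partial)

text \<open>Agreement on the open chart images is enough for the first derivatives to agree there as
  well.\<close>

lemma formal_curvature_cong:
  assumes "\<And>c. c \<in> \<A> \<Longrightarrow> open (chart_image c)" "object_eq \<A> S T"
  shows "object_eq \<A> (formal_curvature S) (formal_curvature T)"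
proof -
  have "partial k (S c I) x = partial k (T c I) x" if "c \<in> \<A>" "x \<in> chart_image c" for c I x k
    using assms that unfolding object_eq_def by (blast intro: partial_cong)
  then show ?thesis
    using assms(2) by (auto simp: object_eq_def formal_curvature_def)
qed

lemma geometrical_object_omega3:
  assumes "\<And>c. c \<in> \<A> \<Longrightarrow> open (chart_image c)"
    and "geometrical_object \<A> (sympart (coeff G))" "geometrical_object \<A> (sympart (coeff G'))"
  shows "geometrical_object \<A> (omega3 G G')"
  unfolding geometrical_object_def omega3_def sympart_deformation
  by (intro ballI allI smooth_on_cmult smooth_on_diff)
    (use assms in \<open>simp_all add: geometrical_object_def del: split_paired_All\<close>)

lemma W_eq_formal_curvature:
  fixes om :: "('m, 'n::finite, 'n \<times> 'n \<times> 'n) built_object"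
  assumes "geometrical_object \<A> (sympart (coeff G))" "geometrical_object \<A> (om G G')"
  shows "object_eq \<A> (W om G G') (formal_curvature (sym_coeff_minus om G G'))"
  unfolding object_eq_def
proof (intro ballI allI)
  fix c :: "('m, 'n) chart" and I :: "'n \<times> 'n \<times> 'n \<times> 'n" and x
  assume c: "c \<in> \<A>" and x: "x \<in> chart_image c"
  obtain i j m n where I: "I = (i, j, m, n)" by (cases I)
  \<comment> \<open>Here smoothness is used: the derivative of the difference splits because both
    terms are differentiable at \<open>x\<close>.\<close>
  have d: "partial k (sym_coeff_minus om G G' c J) x
      = partial k (sympart (coeff G) c J) x - partial k (om G G' c J) x" for k J
    unfolding sym_coeff_minus_def
    using assms c x
    by (intro partial_diff smooth_on_differentiable[of "chart_image c"])
      (simp_all add: geometrical_object_def del: split_paired_All)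
  \<comment> \<open>Of the two mixed terms in each expanded product (S - w)(S - w), one comes from
    either covariant derivative. The \<open>n m\<close> instance of \<open>sympart_swap\<close>
    cancels the terms left over.\<close>
  show "W om G G' c I x = formal_curvature (sym_coeff_minus om G G') c I x"
    unfolding I W_def Let_def curvature_def cov_def formal_curvature_def case_prod_conv d
    unfolding sym_coeff_minus_def
    by (simp add: algebra_simps sum.distrib sum_subtractf sympart_swap[of _ c _ n m])
qed

text \<open>The last assumption reads S' - S = w' - w, which rearranges to S - w = S' - w'.\<close>

lemma invariant_sym_coeff_minus:
  fixes om :: "('m, 'n::finite, 'n \<times> 'n \<times> 'n) built_object"
  assumes "\<And>c. c \<in> \<A> \<Longrightarrow> open (chart_image c)"
    and "geometrical_object \<A> (sympart (coeff G))" "geometrical_object \<A> (om G G')"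
    and "object_eq \<A> (sympart (deformation G G')) (\<lambda>c I x. om G' G c I x - om G G' c I x)"
  shows "invariant \<A> G G' (sym_coeff_minus om)"
  using assms
  by (auto simp: invariant_def geometrical_object_def object_eq_def sympart_deformation
      sym_coeff_minus_def algebra_simps intro!: smooth_on_diff)

text \<open>\<open>W_eq_formal_curvature\<close> is applied to both orders of the spaces, and
  \<open>formal_curvature_cong\<close> links the two resulting expressions through the invariance of
  S - w.\<close>

lemma invariant_W:
  fixes om :: "('m, 'n::finite, 'n \<times> 'n \<times> 'n) built_object"
  assumes "\<And>c. c \<in> \<A> \<Longrightarrow> open (chart_image c)"
    and "geometrical_object \<A> (sympart (coeff G))" "geometrical_object \<A> (om G G')"
    and "geometrical_object \<A> (sympart (coeff G'))" "geometrical_object \<A> (om G' G)"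
    and "invariant \<A> G G' (sym_coeff_minus om)"
  shows "invariant \<A> G G' (W om)"
proof -
  let ?T = "sym_coeff_minus om"
  note eqs = W_eq_formal_curvature[of \<A> G om G', OF assms(2,3)]
    W_eq_formal_curvature[of \<A> G' om G, OF assms(4,5)]
    formal_curvature_cong[OF assms(1), of \<A> "?T G G'" "?T G' G"]
  have "geometrical_object \<A> (formal_curvature (?T G G'))"
    using assms(1,6) by (auto simp: invariant_def intro: geometrical_object_formal_curvature)
  with eqs assms(1,6) show ?thesis
    by (auto simp: invariant_def object_eq_def
        intro!: geometrical_object_cong[of \<A> "formal_curvature (?T G G')"])
qed

theorem lemma2p1:
  fixes X :: "'m topology"
    and \<A> :: "('m, 'n::finite) chart set"
    and G G' :: "('m, 'n) ga_space"
  assumes "smooth_manifold X \<A>"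
    and "is_mapping \<A> G G'"
    and "\<forall>om\<in>{omega1, omega2, omega3}.
      object_eq \<A> (sympart (deformation G G')) (\<lambda>c I x. om G' G c I x - om G G' c I x)"
  shows "invariant \<A> G G' T1 \<and> invariant \<A> G G' T2 \<and> invariant \<A> G G' T3
    \<and> (\<forall>om\<in>{omega1, omega2, omega3}. invariant \<A> G G' (W om))"
proof -
  have op: "open (chart_image c)" if "c \<in> \<A>" for c
    using assms(1) that by (auto simp: smooth_manifold_def is_chart_def)
  have S: "geometrical_object \<A> (sympart (coeff G))" "geometrical_object \<A> (sympart (coeff G'))"
    using assms(2) op
    by (auto simp: is_mapping_def is_ga_space_def affine_connection_def
        intro!: geometrical_object_sympart)
  have om: "geometrical_object \<A> (om G G')" "geometrical_object \<A> (om G' G)"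
    if "om \<in> {omega1, omega2, omega3}" for om
  proof -
    have "geometrical_object \<A> (omega G)" "geometrical_object \<A> (omega G')"
      using assms(2) by (auto simp: is_mapping_def is_ga_space_def)
    \<comment> \<open>Unlike the other two, \<open>omega3\<close> mixes both connections, so each
      order draws on both facts in \<open>S\<close>.\<close>
    moreover have "geometrical_object \<A> (omega3 G G')" "geometrical_object \<A> (omega3 G' G)"
      using S op by (auto intro: geometrical_object_omega3)
    ultimately show "geometrical_object \<A> (om G G')" "geometrical_object \<A> (om G' G)"
      using that S by (auto simp: omega1_def omega2_def)
  qed
  have T: "invariant \<A> G G' (sym_coeff_minus om)" if "om \<in> {omega1, omega2, omega3}" for om
    using invariant_sym_coeff_minus[OF op] S om[OF that] assms(3) that by blast
  moreover have "invariant \<A> G G' (W om)" if "om \<in> {omega1, omega2, omega3}" for om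
    using invariant_W[OF op] S om[OF that] T[OF that] by blast
  ultimately show ?thesis
    by (simp add: T1_eq T2_eq T3_eq)
qed

end
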